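(* Let $p\ge 1$ be an integer, let $L>0$, $c>0$, $v_0<c$, $t_1>0$, and let $\boldsymbol\partial$ be a $p$th order accurate centered finite difference operator (as specified in the context) with associated function $\hat P$. Let $g:\mathbb{R}\to\mathbb{R}$ be $p+2$ times continuously differentiable with $g(t)=0$ for $t\le 0$ and for $t\ge t_1$. Let $F$ be an admissible source profile (as specified in the context) that satisfies $p$ moment conditions and $p+1$ sonic boom conditions. Let $u$ be the exact solution of the $L$-periodic advection problem $u_t+cu_x=g(t)\,\delta(x-v_0t)$, $u(\cdot,0)=0$, with Fourier coefficients $\hat u_k(t)$, and let $\mathbf u$ be the solution of the semidiscrete problem $\frac{d\mathbf u}{dt}+c\,\boldsymbol\partial\mathbf u=g(t)\,\boldsymbol\delta^{v_0t}$, $\mathbf u(0)=0$, on the grid with $M=2N+1$ points and spacing $h=L/M$, with discrete Fourier coefficients $\hat{\mathbf u}_k(t)$, where $\boldsymbol\delta^{x_0}$ is the discrete delta distribution with Fourier coefficients $\hat{\boldsymbol\delta}^{x_0}_k=\frac{e^{-ikx_0}}{L}F(kh)$, $k\in K_N$. Put $\hat{\boldsymbol\varepsilon}_k(t)=\hat{\mathbf u}_k(t)-\hat u_k(t)$ for $k\in K_N$. Then for every $t\ge t_1$ we have $$\hat{\boldsymbol\varepsilon}_0(t)=0,$$ and there is a constant $C$, independent of $k$ and of $N$ (equivalently, of $h$), such that $$|\hat{\boldsymbol\varepsilon}_k(t)|\le C\,\frac{h^p}{|k|}\qquad\text{for all } k\in K_N\setminus\{0\}.$$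
   Context: **Continuous problem.** Functions are $L$-periodic in $x$, and $\delta$ is understood $L$-periodically. Let $K_\infty=\{0,\pm\frac{2\pi}{L},\pm\frac{4\pi}{L},\dots\}$. Fourier coefficients are $\hat u_k=\frac1L\int_0^L e^{-ikx}u(x)\,dx$, $k\in K_\infty$; in particular $\delta(x-x_0)$ has coefficients $\frac1L e^{-ikx_0}$. The exact solution $u$ is the one whose Fourier coefficients solve $\frac{d\hat u_k}{dt}+ikc\,\hat u_k=\frac{g(t)}{L}e^{-ikv_0t}$, $\hat u_k(0)=0$, for all $k\in K_\infty$. **Grid.** For a positive integer $N$ set $M=2N+1$, $h=L/M$, $x_j=(j-1)h$, $j=1,\dots,M$. Grid vectors $\mathbf u=[\mathbf u_1,\dots,\mathbf u_M]^\top$ are indexed periodically. With $K_N=\{0,\pm\frac{2\pi}{L},\dots,\pm N\frac{2\pi}{L}\}$, every grid vector has the expansion $\mathbf u_j=\sum_{k\in K_N}\hat{\mathbf u}_k e^{ikx_j}$ with $\hat{\mathbf u}_k=\frac1L\sum_{j=1}^M h\,e^{-ikx_j}\mathbf u_j$. **Finite difference operator.** A centered finite difference operator is $(\boldsymbol\partial\mathbf u)_j=\frac1h\sum_{l=1}^r a_l(\mathbf u_{j+l}-\mathbf u_{j-l})$ with fixed real coefficients $a_l$ independent of $h$. It acts on Fourier coefficients by $\widehat{(\boldsymbol\partial \mathbf u)}_k=ik\hat P(kh)\hat{\mathbf u}_k$, where $\hat P(\kappa)=\frac{2}{\kappa}\sum_{l=1}^r a_l\sin(l\kappa)$ (extended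 continuously to $\kappa=0$) is real-valued and even. It is $p$th order accurate if $\hat P(\kappa)=1+O(\kappa^p)$ as $\kappa\to0$. It is assumed throughout that $\hat P(\kappa)$ is a strictly decreasing function of $|\kappa|$ on $[-\pi,\pi]$. **Sonic boom wavenumber.** Let $\kappa_*$ denote the smallest $\kappa\in(0,\pi]$ with $c\hat P(\kappa)=v_0$, if one exists; set $k_*=\kappa_*/h$, so $k_*h=\kappa_*$ is independent of $h$. If $\kappa_*$ exists, it is assumed to be a simple zero of $\hat P-\frac{v_0}{c}$, i.e. $\hat P'(\kappa_* )\ne0$. **Admissible source profile.** $F:\mathbb{R}\to\mathbb{R}$ is independent of $h$, bounded, even and sufficiently smooth, meaning: the restriction of $F$ to $[0,\kappa_*]$ (to $[0,\pi]$ if $\kappa_*$ does not exist) is infinitely differentiable up to and including the endpoints (one-sided derivatives). Derivatives of $F$ at the endpoints $0$ and $\kappa_*$ are one-sided derivatives of this restriction. **Moment conditions.** $F$ satisfies $m\ge1$ moment conditions if $F(0)=1$ and $F^{(\nu)}(0)=0$ for $\nu=1,\dots,m-1$. **Sonic boom conditions.** $F$ satisfies $s$ sonic boom conditions if $F^{(\nu)}(\kappa_* )=0$ for $\nu=0,\dots,s-1$ and $F(\kappa)=0$ for $\kappa>\kappa_*$. If $\kappa_*$ does not exist, these conditions are vacuous. *)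

theory Defs
  imports "HOL-Analysis.Analysis" "HOL-Library.Landau_Symbols"
begin

section \<open>Iterated derivatives relative to a set\<close>

text \<open>For \<open>S = {a..b}\<close> with \<open>a < b\<close> these are the derivatives of the restriction of \<open>f\<close> to
  \<open>S\<close>, one-sided at the endpoints; for \<open>S = UNIV\<close> they are the ordinary derivatives.\<close>

primrec deriv_within :: "real set \<Rightarrow> (real \<Rightarrow> real) \<Rightarrow> nat \<Rightarrow> real \<Rightarrow> real" where
  "deriv_within S f 0 = f"
| "deriv_within S f (Suc n) = (\<lambda>x. vector_derivative (deriv_within S f n) (at x within S))"

definition Ck_on :: "nat \<Rightarrow> real set \<Rightarrow> (real \<Rightarrow> real) \<Rightarrow> bool" where
  "Ck_on k S f \<longleftrightarrow>
     (\<forall>n<k. deriv_within S f n differentiable_on S) \<and> continuous_on S (deriv_within S f k)"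

definition smooth_on :: "real set \<Rightarrow> (real \<Rightarrow> real) \<Rightarrow> bool" where
  "smooth_on S f \<longleftrightarrow> (\<forall>k. Ck_on k S f)"


section \<open>Continuous problem\<close>

definition wavenumbers :: "real \<Rightarrow> real set" where
  "wavenumbers L = range (\<lambda>n::int. 2 * pi * of_int n / L)"

definition fourier_coeff :: "real \<Rightarrow> (real \<Rightarrow> complex) \<Rightarrow> real \<Rightarrow> complex" where
  "fourier_coeff L f k = 1 / of_real L * integral {0..L} (\<lambda>x. cis (- (k * x)) * f x)"

text \<open>\<open>u x t\<close> solves \<open>u\<^sub>t + c u\<^sub>x = g(t) \<delta>(x - v\<^sub>0 t)\<close>, \<open>u(x, 0) = 0\<close>, in the sense of Fourier
  coefficients; the periodic \<open>\<delta>(x - x\<^sub>0)\<close> has the coefficients \<open>exp(-\<i> k x\<^sub>0) / L\<close>.\<close>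

definition exact_solution ::
  "real \<Rightarrow> real \<Rightarrow> real \<Rightarrow> (real \<Rightarrow> real) \<Rightarrow> (real \<Rightarrow> real \<Rightarrow> complex) \<Rightarrow> bool" where
  "exact_solution L c v0 g u \<longleftrightarrow>
     (\<forall>t\<ge>0. (\<forall>x. u (x + L) t = u x t) \<and> (\<lambda>x. u x t) absolutely_integrable_on {0..L}) \<and>
     (\<forall>k\<in>wavenumbers L.
        fourier_coeff L (\<lambda>x. u x 0) k = 0 \<and>
        (\<forall>t\<ge>0. ((\<lambda>s. fourier_coeff L (\<lambda>x. u x s) k) has_vector_derivative
            (of_real (g t / L) * cis (- (k * (v0 * t)))
              - \<i> * of_real (k * c) * fourier_coeff L (\<lambda>x. u x t) k)) (at t within {0..})))"


section \<open>Grid\<close>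

definition grid_size :: "nat \<Rightarrow> nat" where
  "grid_size N = 2 * N + 1"

definition grid_spacing :: "real \<Rightarrow> nat \<Rightarrow> real" where
  "grid_spacing L N = L / real (grid_size N)"

definition grid_point :: "real \<Rightarrow> nat \<Rightarrow> int \<Rightarrow> real" where
  "grid_point L N j = of_int (j - 1) * grid_spacing L N"

text \<open>A grid vector is a function on all of \<open>\<int>\<close> that is periodic with period \<open>2 N + 1\<close>.\<close>

definition grid_vector :: "nat \<Rightarrow> (int \<Rightarrow> complex) \<Rightarrow> bool" where
  "grid_vector N w \<longleftrightarrow> (\<forall>j. w (j + int (grid_size N)) = w j)"

definition grid_wavenumbers :: "real \<Rightarrow> nat \<Rightarrow> real set" where
  "grid_wavenumbers L N = (\<lambda>n::int. 2 * pi * of_int n / L) ` {- int N..int N}"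

definition discrete_fourier_coeff :: "real \<Rightarrow> nat \<Rightarrow> (int \<Rightarrow> complex) \<Rightarrow> real \<Rightarrow> complex" where
  "discrete_fourier_coeff L N w k =
     1 / of_real L * (\<Sum>j=1..int (grid_size N).
        of_real (grid_spacing L N) * cis (- (k * grid_point L N j)) * w j)"


section \<open>Finite difference operator\<close>

definition centered_difference ::
  "(nat \<Rightarrow> real) \<Rightarrow> nat \<Rightarrow> real \<Rightarrow> nat \<Rightarrow> (int \<Rightarrow> complex) \<Rightarrow> int \<Rightarrow> complex" where
  "centered_difference a r L N w j =
     1 / of_real (grid_spacing L N) * (\<Sum>l=1..r. of_real (a l) * (w (j + int l) - w (j - int l)))"

text \<open>The value at \<open>0\<close> is the continuous extension, see \<open>isCont_symbol_0\<close>.\<close>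

definition symbol :: "(nat \<Rightarrow> real) \<Rightarrow> nat \<Rightarrow> real \<Rightarrow> real" where
  "symbol a r \<kappa> =
     (if \<kappa> = 0 then 2 * (\<Sum>l=1..r. a l * real l)
      else 2 / \<kappa> * (\<Sum>l=1..r. a l * sin (real l * \<kappa>)))"

definition accurate_of_order :: "nat \<Rightarrow> (real \<Rightarrow> real) \<Rightarrow> bool" where
  "accurate_of_order p P \<longleftrightarrow> (\<lambda>\<kappa>. P \<kappa> - 1) \<in> O[at 0](\<lambda>\<kappa>. \<kappa> ^ p)"

definition strictly_decreasing_in_abs :: "(real \<Rightarrow> real) \<Rightarrow> bool" where
  "strictly_decreasing_in_abs P \<longleftrightarrow>
     (\<forall>x\<in>{-pi..pi}. \<forall>y\<in>{-pi..pi}. \<bar>x\<bar> < \<bar>y\<bar> \<longrightarrow> P y < P x)"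


section \<open>Sonic boom wavenumber and source profile\<close>

definition is_kappa_star :: "(real \<Rightarrow> real) \<Rightarrow> real \<Rightarrow> real \<Rightarrow> real \<Rightarrow> bool" where
  "is_kappa_star P c v0 \<kappa> \<longleftrightarrow>
     \<kappa> \<in> {0<..pi} \<and> c * P \<kappa> = v0 \<and> (\<forall>\<kappa>'\<in>{0<..pi}. c * P \<kappa>' = v0 \<longrightarrow> \<kappa> \<le> \<kappa>')"

definition profile_end :: "(real \<Rightarrow> real) \<Rightarrow> real \<Rightarrow> real \<Rightarrow> real" where
  "profile_end P c v0 =
     (if \<exists>\<kappa>. is_kappa_star P c v0 \<kappa> then THE \<kappa>. is_kappa_star P c v0 \<kappa> else pi)"

definition admissible_profile ::
  "(real \<Rightarrow> real) \<Rightarrow> real \<Rightarrow> real \<Rightarrow> (real \<Rightarrow> real) \<Rightarrow> bool" where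
  "admissible_profile P c v0 F \<longleftrightarrow>
     bounded (range F) \<and> (\<forall>\<kappa>. F (- \<kappa>) = F \<kappa>) \<and> smooth_on {0..profile_end P c v0} F"

definition moment_conditions ::
  "nat \<Rightarrow> (real \<Rightarrow> real) \<Rightarrow> real \<Rightarrow> real \<Rightarrow> (real \<Rightarrow> real) \<Rightarrow> bool" where
  "moment_conditions m P c v0 F \<longleftrightarrow>
     F 0 = 1 \<and> (\<forall>\<nu>\<in>{1..<m}. deriv_within {0..profile_end P c v0} F \<nu> 0 = 0)"

definition sonic_boom_conditions ::
  "nat \<Rightarrow> (real \<Rightarrow> real) \<Rightarrow> real \<Rightarrow> real \<Rightarrow> (real \<Rightarrow> real) \<Rightarrow> bool" where
  "sonic_boom_conditions s P c v0 F \<longleftrightarrow>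
     (\<forall>\<kappa>s. is_kappa_star P c v0 \<kappa>s \<longrightarrow>
        (\<forall>\<nu><s. deriv_within {0..\<kappa>s} F \<nu> \<kappa>s = 0) \<and> (\<forall>\<kappa>>\<kappa>s. F \<kappa> = 0))"


section \<open>Semidiscrete problem\<close>

text \<open>The grid vector with the prescribed discrete Fourier coefficients, see
  \<open>discrete_fourier_coeff_delta\<close>.\<close>

definition discrete_delta :: "real \<Rightarrow> (real \<Rightarrow> real) \<Rightarrow> nat \<Rightarrow> real \<Rightarrow> int \<Rightarrow> complex" where
  "discrete_delta L F N x0 j =
     (\<Sum>k\<in>grid_wavenumbers L N.
        cis (- (k * x0)) / of_real L * of_real (F (k * grid_spacing L N)) * cis (k * grid_point L N j))"

definition semidiscrete_solution ::
  "real \<Rightarrow> real \<Rightarrow> real \<Rightarrow> (nat \<Rightarrow> real) \<Rightarrow> nat \<Rightarrow> (real \<Rightarrow> real) \<Rightarrow> (real \<Rightarrow> real) \<Rightarrow> nat \<Rightarrow>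
    (real \<Rightarrow> int \<Rightarrow> complex) \<Rightarrow> bool" where
  "semidiscrete_solution L c v0 a r g F N U \<longleftrightarrow>
     (\<forall>t\<ge>0. grid_vector N (U t)) \<and>
     (\<forall>j. U 0 j = 0) \<and>
     (\<forall>t\<ge>0. \<forall>j. ((\<lambda>s. U s j) has_vector_derivative
        (of_real (g t) * discrete_delta L F N (v0 * t) j
          - of_real c * centered_difference a r L N (U t) j)) (at t within {0..}))"

definition fourier_error ::
  "real \<Rightarrow> (real \<Rightarrow> real \<Rightarrow> complex) \<Rightarrow> nat \<Rightarrow> (real \<Rightarrow> int \<Rightarrow> complex) \<Rightarrow> real \<Rightarrow> real \<Rightarrow> complex" where
  "fourier_error L u N U t k =
     discrete_fourier_coeff L N (U t) k - fourier_coeff L (\<lambda>x. u x t) k"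


section \<open>Consistency of the definitions\<close>

lemma isCont_symbol_0: "isCont (symbol a r) 0"
proof -
  have lim1: "((\<lambda>x. sin (real l * x) / x) \<longlongrightarrow> real l) (at 0)" for l
  proof -
    have "((\<lambda>x. sin (real l * x)) has_real_derivative real l) (at 0)"
      by (auto intro!: derivative_eq_intros)
    then show ?thesis by (simp add: has_field_derivative_iff)
  qed
  have "((\<lambda>x. 2 * (\<Sum>l=1..r. a l * (sin (real l * x) / x))) \<longlongrightarrow> 2 * (\<Sum>l=1..r. a l * real l)) (at 0)"
    by (intro tendsto_intros lim1)
  moreover have "\<forall>\<^sub>F x in at 0. 2 * (\<Sum>l=1..r. a l * (sin (real l * x) / x)) = symbol a r x"
    by (auto simp: symbol_def eventually_at_filter sum_divide_distrib[symmetric]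
        intro!: always_eventually)
  ultimately have "(symbol a r \<longlongrightarrow> 2 * (\<Sum>l=1..r. a l * real l)) (at 0)"
    by (rule Lim_transform_eventually)
  then show ?thesis by (simp add: isCont_def symbol_def)
qed

lemma is_kappa_star_unique:
  assumes "is_kappa_star P c v0 x" "is_kappa_star P c v0 y"
  shows "x = y"
  using assms unfolding is_kappa_star_def by (intro order_antisym) blast+

lemma profile_end_eq: "is_kappa_star P c v0 \<kappa> \<Longrightarrow> profile_end P c v0 = \<kappa>"
  unfolding profile_end_def using is_kappa_star_unique by (metis the_equality)

lemma grid_character_sum:
  assumes "\<bar>d\<bar> \<le> 2 * int N"
  shows "(\<Sum>j=1..int (grid_size N). cis (2 * pi * of_int d * of_int (j - 1) / real (grid_size N)))
    = (if d = 0 then of_nat (grid_size N) else 0)"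
proof -
  define M where "M = grid_size N"
  have M: "M > 0" "2 * int N < int M" by (auto simp: M_def grid_size_def)
  define w where "w = cis (2 * pi * of_int d / real M)"
  have "(\<Sum>j=1..int M. cis (2 * pi * of_int d * of_int (j - 1) / real M)) = (\<Sum>i<M. w ^ i)"
    by (rule sum.reindex_bij_witness[of _ "\<lambda>i. int i + 1" "\<lambda>j. nat (j - 1)"])
       (auto simp: w_def Complex.DeMoivre of_nat_nat mult_ac right_diff_distrib)
  also have "\<dots> = (if d = 0 then of_nat M else 0)"
  proof (cases "d = 0")
    case False
    have "w \<noteq> 1"
    proof
      assume "w = 1"
      then have "cos (2 * pi * of_int d / real M) = 1"
        by (simp add: w_def complex_eq_iff)
      then obtain n :: int where "2 * pi * of_int d / real M = of_int n * 2 * pi"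
        by (auto simp: cos_one_2pi_int)
      then have "real_of_int d = real_of_int (n * int M)"
        using M by (simp add: field_simps)
      then have "d = n * int M" by linarith
      then have "int M dvd d" by simp
      then have "int M \<le> \<bar>d\<bar>" using False dvd_imp_le_int[of d "int M"] by simp
      then show False using assms M by linarith
    qed
    moreover have "w ^ M = cis (2 * pi * of_int d)"
      using M by (simp add: w_def Complex.DeMoivre)
    then have "w ^ M = 1" by (simp add: cis_multiple_2pi)
    ultimately show ?thesis using False by (simp add: sum_gp_strict)
  qed (simp add: w_def)
  finally show ?thesis by (simp add: M_def)
qed

lemma discrete_fourier_coeff_delta:
  assumes "L > 0" "k \<in> grid_wavenumbers L N"
  shows "discrete_fourier_coeff L N (discrete_delta L F N x0) k =
    cis (- (k * x0)) / of_real L * of_real (F (k * grid_spacing L N))"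
proof -
  define M where "M = grid_size N"
  have M: "M > 0" by (simp add: M_def grid_size_def)
  define \<phi> where "\<phi> n = 2 * pi * of_int n / L" for n :: int
  define C where "C q = cis (- (q * x0)) / of_real L * of_real (F (q * grid_spacing L N))" for q
  obtain m where m: "\<bar>m\<bar> \<le> int N" "k = \<phi> m"
    using assms(2) unfolding grid_wavenumbers_def \<phi>_def by (fastforce simp: abs_le_iff)
  have inj: "inj_on \<phi> {- int N..int N}" using assms by (auto simp: inj_on_def \<phi>_def)
  have chr: "cis (- (\<phi> m * grid_point L N j)) * cis (\<phi> n * grid_point L N j)
      = cis (2 * pi * of_int (n - m) * of_int (j - 1) / real M)" for n j
    using assms(1) M
    by (auto simp: cis_mult \<phi>_def grid_point_def grid_spacing_def M_def[symmetric] field_simps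
        intro!: arg_cong[where f = cis])
  have "discrete_fourier_coeff L N (discrete_delta L F N x0) k =
      (\<Sum>j=1..int M. \<Sum>n\<in>{- int N..int N}. C (\<phi> n) / of_nat M *
        (cis (- (\<phi> m * grid_point L N j)) * cis (\<phi> n * grid_point L N j)))"
    unfolding discrete_fourier_coeff_def discrete_delta_def m(2) M_def[symmetric]
      grid_wavenumbers_def \<phi>_def[symmetric] sum.reindex[OF inj] C_def sum_distrib_left
    using assms(1) M by (intro sum.cong refl) (simp add: grid_spacing_def M_def)
  also have "\<dots> = (\<Sum>n\<in>{- int N..int N}. C (\<phi> n) / of_nat M *
      (\<Sum>j=1..int M. cis (2 * pi * of_int (n - m) * of_int (j - 1) / real M)))"
    unfolding chr by (subst sum.swap) (simp only: sum_distrib_left)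
  also have "\<dots> = (\<Sum>n\<in>{- int N..int N}. if n = m then C (\<phi> n) else 0)"
  proof (intro sum.cong refl)
    fix n assume "n \<in> {- int N..int N}"
    then have "\<bar>n - m\<bar> \<le> 2 * int N" using m by auto
    from grid_character_sum[OF this]
    show "C (\<phi> n) / of_nat M *
      (\<Sum>j=1..int M. cis (2 * pi * of_int (n - m) * of_int (j - 1) / real M))
      = (if n = m then C (\<phi> n) else 0)"
      using M by (simp add: M_def)
  qed
  also have "\<dots> = C k" using m by (auto simp: abs_le_iff)
  finally show ?thesis by (simp add: C_def)
qed

end

theory Submission
  imports Defs
begin

text \<open>
  With \<open>E(\<omega>) = \<integral>\<^sub>0\<^sup>t g(s) exp(\<i>\<omega>(s - t)) ds\<close>, Duhamel's formula gives both Fourier coefficients the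
  common factor \<open>exp(-\<i>k v\<^sub>0 t) / L\<close>, so that up to this factor the error at wavenumber \<open>k\<close> is
  \<open>F(\<kappa>) E(k (c P(\<kappa>) - v\<^sub>0)) - E(k (c - v\<^sub>0))\<close> with \<open>\<kappa> = kh\<close>. Integration by parts bounds
  \<open>|\<omega>|\<^sup>p\<^sup>+\<^sup>1 |E(\<omega>)|\<close> and \<open>|\<omega>|\<^sup>p\<^sup>+\<^sup>2 |E'(\<omega>)|\<close>. For small \<open>\<kappa>\<close> the phase \<open>c P - v\<^sub>0\<close> stays away from zero,
  and \<open>F - 1 = O(\<kappa>\<^sup>p)\<close> together with \<open>P - 1 = O(\<kappa>\<^sup>p)\<close> yields \<open>O(\<kappa>\<^sup>p / |k|\<^sup>p\<^sup>+\<^sup>1) = O(h\<^sup>p / |k|)\<close>. For the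
  other \<open>\<kappa>\<close> it suffices to bound both terms by \<open>O(|k|\<^sup>-\<^sup>p\<^sup>-\<^sup>1)\<close>; for the first one this follows from
  \<open>|F| \<le> C |c P - v\<^sub>0|\<^sup>p\<^sup>+\<^sup>1\<close>, which is what the sonic boom conditions and the simplicity of the
  zero \<open>\<kappa>\<^sub>*\<close> provide.
\<close>

section \<open>Taylor bounds\<close>

text \<open>On the segment from \<open>x0\<close> to \<open>x\<close> the bound on \<open>f'\<close>
  is at most the constant \<open>B * \<bar>x - x0\<bar> ^ j\<close>, so the mean value inequality
  gains one power. The Taylor factor \<open>1 / (j + 1)\<close> is given up, since only the
  existence of a constant matters.\<close>

lemma derivative_bound_imp_power_bound:
  fixes f f' :: "real \<Rightarrow> real"
  assumes S: "convex S" "x0 \<in> S" "x \<in> S"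
    and der: "\<And>y. y \<in> S \<Longrightarrow> (f has_vector_derivative f' y) (at y within S)"
    and bd: "\<And>y. y \<in> S \<Longrightarrow> \<bar>f' y\<bar> \<le> B * \<bar>y - x0\<bar> ^ j" and "0 \<le> B"
  shows "\<bar>f x - f x0\<bar> \<le> B * \<bar>x - x0\<bar> ^ Suc j"
proof -
  have sub: "closed_segment x0 x \<subseteq> S" by (rule closed_segment_subset) (use S in auto)
  have "norm (f x - f x0) \<le> B * \<bar>x - x0\<bar> ^ j * norm (x - x0)"
  proof (rule field_differentiable_bound[where S = "closed_segment x0 x" and f' = f'])
    fix z assume z: "z \<in> closed_segment x0 x"
    show "(f has_field_derivative f' z) (at z within closed_segment x0 x)"
      using der[of z] z sub
      by (meson DERIV_subset has_real_derivative_iff_has_vector_derivative subsetD)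
    have "\<bar>z - x0\<bar> \<le> \<bar>x - x0\<bar>"
      using z by (auto simp: closed_segment_eq_real_ivl split: if_splits)
    then have "B * \<bar>z - x0\<bar> ^ j \<le> B * \<bar>x - x0\<bar> ^ j"
      by (intro mult_left_mono power_mono) (use \<open>0 \<le> B\<close> in auto)
    then show "norm (f' z) \<le> B * \<bar>x - x0\<bar> ^ j" using bd[of z] z sub by force
  qed auto
  then show ?thesis by (simp add: mult_ac)
qed

lemma Ck_on_has_vector_derivative:
  assumes "Ck_on m S f" "n < m" "x \<in> S"
  shows "(deriv_within S f n has_vector_derivative deriv_within S f (Suc n) x) (at x within S)"
  using assms by (auto simp: Ck_on_def differentiable_on_def vector_derivative_works[symmetric])

text \<open>The top derivative is bounded by compactness, and each integration from
  \<open>x0\<close> gains a power of the distance. As \<open>x0\<close> may be an endpoint, this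
  serves the moment conditions at 0 and the sonic boom conditions at
  \<open>\<kappa>\<^sub>*\<close>.\<close>

lemma Ck_on_taylor_bound:
  assumes f: "Ck_on m {a..b} f" and m: "m \<ge> 1" and x0: "x0 \<in> {a..b}"
    and zero: "\<And>\<nu>. \<nu> \<in> {1..<m} \<Longrightarrow> deriv_within {a..b} f \<nu> x0 = 0"
  shows "\<exists>B\<ge>0. \<forall>x\<in>{a..b}. \<bar>f x - f x0\<bar> \<le> B * \<bar>x - x0\<bar> ^ m"
proof -
  let ?D = "deriv_within {a..b} f"
  have "compact (?D m ` {a..b})"
    by (rule compact_continuous_image) (use f in \<open>auto simp: Ck_on_def\<close>)
  then obtain B where B: "0 < B" "\<And>x. x \<in> {a..b} \<Longrightarrow> \<bar>?D m x\<bar> \<le> B"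
    by (auto dest!: compact_imp_bounded simp: bounded_pos)
  \<comment> \<open>Induction downwards in the order \<open>m - j\<close> of the derivative. Only
    order 0, reached at \<open>j = m\<close>, may have a nonzero value at \<open>x0\<close>, which
    is then subtracted.\<close>
  have *: "\<forall>x\<in>{a..b}. \<bar>?D (m - j) x - (if j = m then ?D 0 x0 else 0)\<bar> \<le> B * \<bar>x - x0\<bar> ^ j"
    if "j \<le> m" for j
    using that
  proof (induction j)
    case 0
    then show ?case using B m by auto
  next
    case (Suc j)
    then have j: "Suc (m - Suc j) = m - j" "j \<noteq> m" by auto
    show ?case
    proof
      fix x assume x: "x \<in> {a..b}"
      have "\<bar>?D (m - Suc j) x - ?D (m - Suc j) x0\<bar> \<le> B * \<bar>x - x0\<bar> ^ Suc j"
      proof (rule derivative_bound_imp_power_bound[where S = "{a..b}"])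
        fix y assume y: "y \<in> {a..b}"
        show "(?D (m - Suc j) has_vector_derivative ?D (m - j) y) (at y within {a..b})"
          using Ck_on_has_vector_derivative[OF f _ y, of "m - Suc j"] j Suc.prems by simp
        show "\<bar>?D (m - j) y\<bar> \<le> B * \<bar>y - x0\<bar> ^ j" using Suc j y by auto
      qed (use x x0 B in auto)
      moreover have "?D (m - Suc j) x0 = (if Suc j = m then ?D 0 x0 else 0)"
        using zero[of "m - Suc j"] Suc.prems by auto
      ultimately show "\<bar>?D (m - Suc j) x - (if Suc j = m then ?D 0 x0 else 0)\<bar>
          \<le> B * \<bar>x - x0\<bar> ^ Suc j" by simp
    qed
  qed
  show ?thesis using *[of m] B by (auto intro!: exI[of _ B])
qed

text \<open>Since every point of \<open>T\<close> is a limit of other points of \<open>T\<close>,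
  difference quotients taken inside \<open>T\<close> already determine the two-sided derivative,
  also at boundary points of \<open>T\<close>.\<close>

lemma deriv_within_vanishes:
  assumes f: "Ck_on m UNIV f" and n: "n \<le> m"
    and T: "\<And>x. x \<in> T \<Longrightarrow> at x within T \<noteq> bot" and zero: "\<And>x. x \<in> T \<Longrightarrow> f x = 0"
    and x: "x \<in> T"
  shows "deriv_within UNIV f n x = 0"
  using n x
proof (induction n arbitrary: x)
  case 0
  then show ?case using zero by simp
next
  case (Suc n)
  have "(deriv_within UNIV f n has_vector_derivative deriv_within UNIV f (Suc n) x) (at x within T)"
    using Ck_on_has_vector_derivative[OF f, of n x] Suc.prems
    by (auto intro: has_vector_derivative_at_within)
  moreover have "(deriv_within UNIV f n has_vector_derivative 0) (at x within T)"
    by (rule has_vector_derivative_transform[OF Suc.prems(2) _ has_vector_derivative_const])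
      (use Suc in auto)
  ultimately show ?case using T Suc.prems(2) vector_derivative_unique_within by blast
qed

section \<open>Oscillatory integrals and Duhamel's formula\<close>

lemma has_vector_derivative_cis_linear:
  "((\<lambda>s. cis (\<omega> * (s - t))) has_vector_derivative \<i> * of_real \<omega> * cis (\<omega> * (s - t)))
    (at s within S)"
  unfolding has_vector_derivative_def
  by (auto intro!: derivative_eq_intros simp: scaleR_conv_of_real mult_ac)

lemma oscillatory_integral_decay:
  fixes D :: "nat \<Rightarrow> real \<Rightarrow> real"
  assumes "0 \<le> t"
    and der: "\<And>n s. n < m \<Longrightarrow> s \<in> {0..t} \<Longrightarrow>
      (D n has_vector_derivative D (Suc n) s) (at s within {0..t})"
    and cont: "continuous_on {0..t} (D m)"
    and ends: "\<And>n. n < m \<Longrightarrow> D n 0 = 0" "\<And>n. n < m \<Longrightarrow> D n t = 0"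
  shows "\<exists>B\<ge>0. \<forall>\<omega>. \<bar>\<omega>\<bar> ^ m *
    cmod (integral {0..t} (\<lambda>s. of_real (D 0 s) * cis (\<omega> * (s - t)))) \<le> B"
proof -
  have contn: "continuous_on {0..t} (D n)" if "n \<le> m" for n
  proof (cases "n = m")
    case False
    then show ?thesis
      by (intro continuous_on_vector_derivative[of _ _ "D (Suc n)"] der) (use that in auto)
  qed (simp add: cont)
  define I where "I \<omega> n = integral {0..t} (\<lambda>s. of_real (D n s) * cis (\<omega> * (s - t)))" for \<omega> n
  have int: "(\<lambda>s. of_real (D n s) * cis (\<omega> * (s - t))) integrable_on {0..t}" if "n \<le> m" for n \<omega>
    by (intro integrable_continuous_real continuous_intros contn that)
  \<comment> \<open>One integration by parts: the derivative of the product of \<open>D n\<close>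
    and the exponential integrates to its boundary values, which are zero.\<close>
  have step: "I \<omega> (Suc n) = - (\<i> * of_real \<omega> * I \<omega> n)" if n: "n < m" for \<omega> n
  proof -
    have "((\<lambda>s. of_real (D (Suc n) s) * cis (\<omega> * (s - t))
        + \<i> * of_real \<omega> * (of_real (D n s) * cis (\<omega> * (s - t)))) has_integral
        of_real (D n t) * cis (\<omega> * (t - t)) - of_real (D n 0) * cis (\<omega> * (0 - t))) {0..t}"
    proof (rule fundamental_theorem_of_calculus[OF \<open>0 \<le> t\<close>])
      fix s assume s: "s \<in> {0..t}"
      have "((\<lambda>s. complex_of_real (D n s)) has_vector_derivative of_real (D (Suc n) s))
          (at s within {0..t})"
        by (rule has_vector_derivative_of_real[OF der[OF n s, folded has_real_derivative_iff_has_vector_derivative]])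
      from has_vector_derivative_mult[OF this has_vector_derivative_cis_linear[of \<omega> t]]
      show "((\<lambda>s. of_real (D n s) * cis (\<omega> * (s - t))) has_vector_derivative
          of_real (D (Suc n) s) * cis (\<omega> * (s - t))
        + \<i> * of_real \<omega> * (of_real (D n s) * cis (\<omega> * (s - t)))) (at s within {0..t})"
        by (simp add: algebra_simps)
    qed
    moreover have "((\<lambda>s. of_real (D (Suc n) s) * cis (\<omega> * (s - t))
        + \<i> * of_real \<omega> * (of_real (D n s) * cis (\<omega> * (s - t)))) has_integral
        I \<omega> (Suc n) + \<i> * of_real \<omega> * I \<omega> n) {0..t}"
      unfolding I_def
      by (intro has_integral_add has_integral_mult_right integrable_integral int) (use n in auto)
    ultimately have "of_real (D n t) * cis (\<omega> * (t - t)) - of_real (D n 0) * cis (\<omega> * (0 - t))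
        = I \<omega> (Suc n) + \<i> * of_real \<omega> * I \<omega> n"
      by (rule has_integral_unique)
    then have "I \<omega> (Suc n) + \<i> * of_real \<omega> * I \<omega> n = 0" by (simp add: ends[OF n])
    then show ?thesis by (simp add: eq_neg_iff_add_eq_0)
  qed
  have pow: "\<bar>\<omega>\<bar> ^ n * cmod (I \<omega> 0) = cmod (I \<omega> n)" if "n \<le> m" for \<omega> n
    using that
  proof (induction n)
    case (Suc n)
    have "cmod (I \<omega> (Suc n)) = \<bar>\<omega>\<bar> * cmod (I \<omega> n)"
      using Suc.prems by (simp add: step norm_mult)
    then show ?case using Suc by (simp add: mult.assoc)
  qed simp
  have "compact (D m ` {0..t})" by (rule compact_continuous_image[OF cont]) auto
  then obtain B where B: "0 < B" "\<And>s. s \<in> {0..t} \<Longrightarrow> \<bar>D m s\<bar> \<le> B"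
    by (auto dest!: compact_imp_bounded simp: bounded_pos)
  have "cmod (I \<omega> m) \<le> B * t" for \<omega>
  proof -
    have "continuous_on {0..t} (\<lambda>s. of_real (D m s) * cis (\<omega> * (s - t)))"
      by (intro continuous_intros cont)
    then have "cmod (I \<omega> m) \<le> B * (t - 0)"
      unfolding I_def by (rule integral_bound[OF \<open>0 \<le> t\<close>]) (auto simp: norm_mult B)
    then show ?thesis by simp
  qed
  then show ?thesis using pow[of m] B \<open>0 \<le> t\<close> unfolding I_def[symmetric]
    by (intro exI[of _ "B * t"]) auto
qed

text \<open>The integrating factor \<open>cis (\<omega> * (s - t))\<close> equals 1 at
  \<open>s = t\<close>, so the fundamental theorem of calculus returns \<open>y t\<close>
  itself.\<close>

lemma linear_ode_duhamel:
  fixes y :: "real \<Rightarrow> complex" and g :: "real \<Rightarrow> real"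
  assumes "0 \<le> t" and "y 0 = 0"
    and der: "\<And>s. s \<ge> 0 \<Longrightarrow> (y has_vector_derivative
       (A * of_real (g s) * cis (- (\<alpha> * s)) - \<i> * of_real \<omega> * y s)) (at s within {0..})"
  shows "y t = A * cis (- (\<alpha> * t)) *
    integral {0..t} (\<lambda>s. of_real (g s) * cis ((\<omega> - \<alpha>) * (s - t)))"
proof -
  have "((\<lambda>s. A * cis (- (\<alpha> * t)) * (of_real (g s) * cis ((\<omega> - \<alpha>) * (s - t)))) has_integral
      y t * cis (\<omega> * (t - t)) - y 0 * cis (\<omega> * (0 - t))) {0..t}"
  proof (rule fundamental_theorem_of_calculus[OF \<open>0 \<le> t\<close>])
    fix s assume s: "s \<in> {0..t}"
    have "((\<lambda>s. cis (\<omega> * (s - t))) has_vector_derivative \<i> * of_real \<omega> * cis (\<omega> * (s - t)))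
        (at s within {0..t})"
      by (rule has_vector_derivative_cis_linear)
    moreover have "(y has_vector_derivative
       (A * of_real (g s) * cis (- (\<alpha> * s)) - \<i> * of_real \<omega> * y s)) (at s within {0..t})"
      by (rule has_vector_derivative_within_subset[OF der]) (use s in auto)
    \<comment> \<open>Moves the forcing phase to the final time \<open>t\<close>; only the detuning
      \<open>\<omega> - \<alpha>\<close> stays under the integral.\<close>
    moreover have "cis (- (\<alpha> * t)) * cis ((\<omega> - \<alpha>) * (s - t)) = cis (- (\<alpha> * s)) * cis (\<omega> * (s - t))"
      by (simp add: cis_mult algebra_simps)
    ultimately show "((\<lambda>s. y s * cis (\<omega> * (s - t))) has_vector_derivative
        A * cis (- (\<alpha> * t)) * (of_real (g s) * cis ((\<omega> - \<alpha>) * (s - t)))) (at s within {0..t})"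
      by (auto intro!: derivative_eq_intros simp: algebra_simps)
  qed
  from integral_unique[OF this] show ?thesis using \<open>y 0 = 0\<close>
    by (simp add: integral_mult_right)
qed

section \<open>Fourier coefficients of the two solutions\<close>

text \<open>A shift by one trades the index 1 for \<open>M + 1\<close>, where a periodic function
  has the same value.\<close>

lemma periodic_sum_shift:
  fixes f :: "int \<Rightarrow> 'a::ab_group_add"
  assumes per: "\<And>j. f (j + int M) = f j"
  shows "(\<Sum>j=1..int M. f (j + int l)) = (\<Sum>j=1..int M. f j)"
proof (induction l)
  case (Suc l)
  have "(\<Sum>j=1..int M. f (j + int (Suc l))) = (\<Sum>j\<in>{2..int M + 1}. f (j + int l))"
    by (rule sum.reindex_bij_witness[of _ "\<lambda>j. j - 1" "\<lambda>j. j + 1"]) (auto simp: algebra_simps)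
  also have "\<dots> = (\<Sum>j=1..int M. f (j + int l))"
  proof (cases "M = 0")
    case False
    have "{2..int M + 1} = insert (int M + 1) {2..int M}" "{1..int M} = insert 1 {2..int M}"
      using False by auto
    moreover have "f (int M + 1 + int l) = f (1 + int l)"
      using per[of "1 + int l"] by (simp add: algebra_simps)
    ultimately show ?thesis by simp
  qed simp
  finally show ?case using Suc by simp
qed simp

lemma grid_spacing_pos: "L > 0 \<Longrightarrow> grid_spacing L N > 0"
  by (simp add: grid_spacing_def grid_size_def)

lemma cis_grid_point_periodic:
  assumes "L > 0" "k \<in> grid_wavenumbers L N"
  shows "cis (- (k * grid_point L N (j + int (grid_size N)))) = cis (- (k * grid_point L N j))"
proof -
  obtain n :: int where n: "k = 2 * pi * of_int n / L"
    using assms(2) by (auto simp: grid_wavenumbers_def)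
  have "grid_point L N (j + int (grid_size N)) = grid_point L N j + L"
  proof -
    have "real (grid_size N) * grid_spacing L N = L"
      by (simp add: grid_spacing_def grid_size_def)
    then show ?thesis by (simp add: grid_point_def algebra_simps)
  qed
  then have "- (k * grid_point L N (j + int (grid_size N)))
      = - (k * grid_point L N j) + 2 * pi * of_int (- n)"
    using assms(1) by (simp add: n field_simps)
  then show ?thesis by (simp only: cis_mult[symmetric] cis_multiple_2pi Ints_of_int) simp
qed

text \<open>The character \<open>q\<close> changes by a constant phase under an index shift, and the
  sum of the periodic product \<open>q j * w j\<close> over a full period does not change at
  all.\<close>

lemma discrete_fourier_coeff_shift:
  assumes L: "L > 0" and k: "k \<in> grid_wavenumbers L N" and w: "grid_vector N w"
  shows "discrete_fourier_coeff L N (\<lambda>j. w (j + int l)) k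
      = cis (k * (real l * grid_spacing L N)) * discrete_fourier_coeff L N w k"
    and "discrete_fourier_coeff L N (\<lambda>j. w (j - int l)) k
      = cis (- (k * (real l * grid_spacing L N))) * discrete_fourier_coeff L N w k"
proof -
  define q where "q j = cis (- (k * grid_point L N j))" for j
  have shift: "q j = cis (k * (real l * grid_spacing L N)) * q (j + int l)" for j l
    by (simp add: q_def cis_mult grid_point_def algebra_simps)
  have up: "(\<Sum>j=1..int (grid_size N). q j * w (j + int l))
      = cis (k * (real l * grid_spacing L N)) * (\<Sum>j=1..int (grid_size N). q j * w j)"
    if w: "grid_vector N w" for w
  proof -
    have "(\<Sum>j=1..int (grid_size N). q j * w (j + int l))
        = cis (k * (real l * grid_spacing L N)) *
          (\<Sum>j=1..int (grid_size N). q (j + int l) * w (j + int l))"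
      unfolding sum_distrib_left by (subst shift[of _ l]) (simp add: mult_ac)
    also have "(\<Sum>j=1..int (grid_size N). q (j + int l) * w (j + int l))
        = (\<Sum>j=1..int (grid_size N). q j * w j)"
      by (rule periodic_sum_shift[of "\<lambda>j. q j * w j"])
        (use w cis_grid_point_periodic[OF L k] in \<open>auto simp: q_def grid_vector_def\<close>)
    finally show ?thesis .
  qed
  have eq: "discrete_fourier_coeff L N w k
      = of_real (grid_spacing L N / L) * (\<Sum>j=1..int (grid_size N). q j * w j)" for w
    by (simp add: discrete_fourier_coeff_def q_def sum_distrib_left mult_ac)
  show "discrete_fourier_coeff L N (\<lambda>j. w (j + int l)) k
      = cis (k * (real l * grid_spacing L N)) * discrete_fourier_coeff L N w k"
    unfolding eq up[OF w] by simp
  have "grid_vector N (\<lambda>j. w (j - int l))"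
    unfolding grid_vector_def
  proof
    fix j show "w (j + int (grid_size N) - int l) = w (j - int l)"
      using w[unfolded grid_vector_def, rule_format, of "j - int l"] by (simp add: algebra_simps)
  qed
  \<comment> \<open>The backward rule is the forward rule for the backward shifted vector, solved
    for its coefficient.\<close>
  from up[OF this]
  have "discrete_fourier_coeff L N w k = cis (k * (real l * grid_spacing L N)) *
      discrete_fourier_coeff L N (\<lambda>j. w (j - int l)) k"
    unfolding eq by simp
  then show "discrete_fourier_coeff L N (\<lambda>j. w (j - int l)) k
      = cis (- (k * (real l * grid_spacing L N))) * discrete_fourier_coeff L N w k"
    by (simp add: mult.assoc[symmetric] cis_mult)
qed

lemma discrete_fourier_coeff_diff:
  "discrete_fourier_coeff L N (\<lambda>j. v j - w j) k
    = discrete_fourier_coeff L N v k - discrete_fourier_coeff L N w k"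
  by (simp add: discrete_fourier_coeff_def ring_distribs sum_subtractf)

lemma discrete_fourier_coeff_cmult:
  "discrete_fourier_coeff L N (\<lambda>j. b * w j) k = b * discrete_fourier_coeff L N w k"
  by (simp add: discrete_fourier_coeff_def sum_distrib_left mult_ac)

lemma discrete_fourier_coeff_sum:
  "discrete_fourier_coeff L N (\<lambda>j. \<Sum>i\<in>I. w i j) k = (\<Sum>i\<in>I. discrete_fourier_coeff L N (w i) k)"
  unfolding discrete_fourier_coeff_def sum_distrib_left by (rule sum.swap)

text \<open>The shifts by \<open>l\<close> and \<open>- l\<close> combine to
  \<open>2 * \<i> * sin (l k h)\<close>, so the operator is diagonal in Fourier space.\<close>

lemma discrete_fourier_coeff_centered_difference:
  assumes L: "L > 0" and k: "k \<in> grid_wavenumbers L N" and w: "grid_vector N w"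
  shows "discrete_fourier_coeff L N (centered_difference a r L N w) k
      = \<i> * of_real (k * symbol a r (k * grid_spacing L N)) * discrete_fourier_coeff L N w k"
proof -
  define h where "h = grid_spacing L N"
  have h: "h > 0" using grid_spacing_pos[OF L] by (simp add: h_def)
  have sin: "cis (k * (real l * h)) - cis (- (k * (real l * h)))
      = \<i> * of_real (2 * sin (real l * (k * h)))" for l
    by (simp add: complex_eq_iff mult_ac)
  \<comment> \<open>At \<open>k = 0\<close> both sides are zero, whatever value the symbol takes
    there.\<close>
  have sym: "1 / h * (\<Sum>l=1..r. a l * (2 * sin (real l * (k * h)))) = k * symbol a r (k * h)"
    using h by (cases "k = 0") (simp_all add: symbol_def sum_distrib_left mult_ac)
  have "discrete_fourier_coeff L N (centered_difference a r L N w) k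
      = 1 / of_real h * (\<Sum>l=1..r. of_real (a l) *
          ((cis (k * (real l * h)) - cis (- (k * (real l * h)))) * discrete_fourier_coeff L N w k))"
    unfolding centered_difference_def[abs_def] discrete_fourier_coeff_cmult
      discrete_fourier_coeff_sum discrete_fourier_coeff_diff
      discrete_fourier_coeff_shift[OF assms] h_def[symmetric]
    by (simp add: left_diff_distrib)
  also have "\<dots> = \<i> * of_real (1 / h * (\<Sum>l=1..r. a l * (2 * sin (real l * (k * h)))))
      * discrete_fourier_coeff L N w k"
    unfolding sin by (simp add: sum_distrib_left sum_distrib_right mult_ac)
  finally show ?thesis unfolding sym unfolding h_def .
qed

text \<open>The function E of the overview. Measuring the phase from the final time \<open>t\<close>
  leaves the same prefactor for the exact and the discrete coefficient.\<close>

definition source_transform :: "(real \<Rightarrow> real) \<Rightarrow> real \<Rightarrow> real \<Rightarrow> complex" where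
  "source_transform g t \<omega> = integral {0..t} (\<lambda>s. of_real (g s) * cis (\<omega> * (s - t)))"

lemma exact_fourier_coeff:
  assumes "exact_solution L c v0 g u" "k \<in> wavenumbers L" "t \<ge> 0"
  shows "fourier_coeff L (\<lambda>x. u x t) k
    = 1 / of_real L * cis (- (k * v0 * t)) * source_transform g t (k * (c - v0))"
proof -
  have "fourier_coeff L (\<lambda>x. u x t) k = 1 / of_real L * cis (- ((k * v0) * t)) *
     integral {0..t} (\<lambda>s. of_real (g s) * cis ((k * c - k * v0) * (s - t)))"
    by (rule linear_ode_duhamel)
      (use assms in \<open>auto simp: exact_solution_def mult_ac\<close>)
  then show ?thesis by (simp add: source_transform_def algebra_simps)
qed

text \<open>Taking coefficients decouples the system into scalar equations; Duhamel's formula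
  applies with the frequency \<open>k * c * symbol a r (k * h)\<close> in place of the exact
  \<open>k * c\<close>.\<close>

lemma semidiscrete_fourier_coeff:
  assumes U: "semidiscrete_solution L c v0 a r g F N U" and L: "L > 0"
    and k: "k \<in> grid_wavenumbers L N" and t: "t \<ge> 0"
  shows "discrete_fourier_coeff L N (U t) k
    = 1 / of_real L * cis (- (k * v0 * t)) * (of_real (F (k * grid_spacing L N)) *
        source_transform g t (k * (c * symbol a r (k * grid_spacing L N) - v0)))"
proof -
  define h where "h = grid_spacing L N"
  have "discrete_fourier_coeff L N (U t) k = of_real (F (k * h)) / of_real L * cis (- ((k * v0) * t)) *
     integral {0..t} (\<lambda>s. of_real (g s) * cis ((k * c * symbol a r (k * h) - k * v0) * (s - t)))"
  proof (rule linear_ode_duhamel[OF t])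
    show "discrete_fourier_coeff L N (U 0) k = 0"
      using U by (simp add: semidiscrete_solution_def discrete_fourier_coeff_def)
  next
    fix s :: real assume s: "s \<ge> 0"
    define R where "R j = of_real (g s) * discrete_delta L F N (v0 * s) j
        - of_real c * centered_difference a r L N (U s) j" for j
    have "((\<lambda>s. discrete_fourier_coeff L N (U s) k) has_vector_derivative
        discrete_fourier_coeff L N R k) (at s within {0..})"
      unfolding discrete_fourier_coeff_def
      by (intro has_vector_derivative_mult_right has_vector_derivative_sum)
        (use U s in \<open>auto simp: semidiscrete_solution_def R_def\<close>)
    moreover have "grid_vector N (U s)" using U s by (simp add: semidiscrete_solution_def)
    then have "discrete_fourier_coeff L N R k
        = of_real (F (k * h)) / of_real L * of_real (g s) * cis (- ((k * v0) * s)) -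
          \<i> * of_real (k * c * symbol a r (k * h)) * discrete_fourier_coeff L N (U s) k"
      unfolding R_def[abs_def] discrete_fourier_coeff_diff discrete_fourier_coeff_cmult
        discrete_fourier_coeff_delta[OF L k] h_def
      by (simp add: discrete_fourier_coeff_centered_difference[OF L k] mult_ac)
    ultimately show "((\<lambda>s. discrete_fourier_coeff L N (U s) k) has_vector_derivative
          of_real (F (k * h)) / of_real L * of_real (g s) * cis (- ((k * v0) * s)) -
          \<i> * of_real (k * c * symbol a r (k * h)) * discrete_fourier_coeff L N (U s) k)
        (at s within {0..})" by simp
  qed
  then show ?thesis by (simp add: source_transform_def h_def algebra_simps)
qed

section \<open>Decay of the source transform\<close>

context
  fixes g :: "real \<Rightarrow> real" and m :: nat and t :: real
  assumes g: "Ck_on m UNIV g" and t: "0 \<le> t"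
    and zero: "\<And>s. s \<le> 0 \<Longrightarrow> g s = 0" "\<And>s. s \<ge> t \<Longrightarrow> g s = 0"
begin

lemma source_derivative:
  "n < m \<Longrightarrow> (deriv_within UNIV g n has_vector_derivative deriv_within UNIV g (Suc n) s) (at s within S)"
  using Ck_on_has_vector_derivative[OF g, of n s] by (auto intro: has_vector_derivative_at_within)

lemma source_derivative_continuous: "n \<le> m \<Longrightarrow> continuous_on S (deriv_within UNIV g n)"
proof (cases "n = m")
  case True
  then show ?thesis using g by (auto simp: Ck_on_def intro: continuous_on_subset)
next
  case False
  assume "n \<le> m"
  with False show ?thesis
    by (intro continuous_on_vector_derivative[of _ _ "deriv_within UNIV g (Suc n)"] source_derivative)
      auto
qed

text \<open>The closed half-lines \<open>{..0}\<close> and \<open>{t..}\<close>, on which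
  \<open>g\<close> vanishes, contain the endpoints. This removes all boundary terms.\<close>

lemma source_derivative_ends:
  assumes "n \<le> m"
  shows "deriv_within UNIV g n 0 = 0" "deriv_within UNIV g n t = 0"
proof -
  show "deriv_within UNIV g n 0 = 0"
  proof (rule deriv_within_vanishes[OF g assms, of "{..0}"])
    fix x :: real assume "x \<in> {..0}"
    then have "at_left x \<le> at x within {..0}" by (intro at_le) auto
    then show "at x within {..0} \<noteq> bot" using trivial_limit_at_left_real[of x] by (metis le_bot)
  qed (auto simp: zero)
  show "deriv_within UNIV g n t = 0"
  proof (rule deriv_within_vanishes[OF g assms, of "{t..}"])
    fix x :: real assume "x \<in> {t..}"
    then have "at_right x \<le> at x within {t..}" by (intro at_le) auto
    then show "at x within {t..} \<noteq> bot" using trivial_limit_at_right_real[of x] by (metis le_bot)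
  qed (auto simp: zero)
qed

lemma source_transform_decay:
  assumes "n \<le> m"
  shows "\<exists>B\<ge>0. \<forall>\<omega>. \<bar>\<omega>\<bar> ^ n * cmod (source_transform g t \<omega>) \<le> B"
  using oscillatory_integral_decay[of t n "deriv_within UNIV g"] t assms
  by (simp add: source_transform_def source_derivative_ends source_derivative_continuous
      source_derivative del: deriv_within.simps(2))

text \<open>Differentiation in the frequency puts the factor \<open>s - t\<close> in front of
  \<open>g\<close>, which costs no smoothness, so E' decays with power \<open>m\<close>. The mean
  value inequality on a convex set that keeps distance \<open>d\<close> from zero gives the claim,
  with \<open>B\<close> independent of the set and of \<open>d\<close>.\<close>

lemma source_transform_difference_decay:
  "\<exists>B\<ge>0. \<forall>U d x y::real. convex U \<longrightarrow> x \<in> U \<longrightarrow> y \<in> U \<longrightarrow> 0 < d \<longrightarrow> (\<forall>z\<in>U. d \<le> \<bar>z\<bar>) \<longrightarrow>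
     cmod (source_transform g t x - source_transform g t y) \<le> B / d ^ m * \<bar>x - y\<bar>"
proof -
  \<comment> \<open>Leibniz formula for the \<open>n\<close>-th derivative of
    \<open>(s - t) * g s\<close>. At \<open>n = 0\<close> the truncated index \<open>n - 1\<close>
    is harmless because of the factor \<open>real n\<close>.\<close>
  define D where "D n s = (s - t) * deriv_within UNIV g n s + real n * deriv_within UNIV g (n - 1) s"
    for n s
  have "\<exists>B\<ge>0. \<forall>\<omega>. \<bar>\<omega>\<bar> ^ m *
      cmod (integral {0..t} (\<lambda>s. of_real (D 0 s) * cis (\<omega> * (s - t)))) \<le> B"
  proof (rule oscillatory_integral_decay[OF t])
    fix n s assume n: "n < m" and "s \<in> {0..t}"
    show "(D n has_vector_derivative D (Suc n) s) (at s within {0..t})"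
    proof (cases n)
      case 0
      have "((\<lambda>s. (s - t) * deriv_within UNIV g n s) has_vector_derivative
          (s - t) * deriv_within UNIV g (Suc n) s + deriv_within UNIV g n s) (at s within {0..t})"
        using source_derivative[OF n, of s "{0..t}"]
        unfolding has_real_derivative_iff_has_vector_derivative[symmetric]
        by (auto intro!: derivative_eq_intros simp del: deriv_within.simps(2))
      then show ?thesis using 0 by (simp add: D_def[abs_def] del: deriv_within.simps(2))
    next
      case (Suc l)
      have "((\<lambda>s. (s - t) * deriv_within UNIV g n s + real n * deriv_within UNIV g l s)
          has_vector_derivative (s - t) * deriv_within UNIV g (Suc n) s + deriv_within UNIV g n s
            + real n * deriv_within UNIV g (Suc l) s) (at s within {0..t})"
        using source_derivative[OF n, of s "{0..t}"] source_derivative[of l s "{0..t}"] Suc n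
        unfolding has_real_derivative_iff_has_vector_derivative[symmetric]
        by (auto intro!: derivative_eq_intros simp del: deriv_within.simps(2))
      then show ?thesis
        using Suc by (simp add: D_def[abs_def] algebra_simps del: deriv_within.simps(2))
    qed
  next
    show "continuous_on {0..t} (D m)"
      unfolding D_def[abs_def] by (intro continuous_intros source_derivative_continuous) auto
  qed (simp_all add: D_def source_derivative_ends)
  then obtain B where B: "B \<ge> 0" "\<And>\<omega>. \<bar>\<omega>\<bar> ^ m *
      cmod (integral {0..t} (\<lambda>s. of_real (D 0 s) * cis (\<omega> * (s - t)))) \<le> B" by blast
  have gc: "continuous_on S g" for S using source_derivative_continuous[of 0] by simp
  \<comment> \<open>The derivative of the transform, obtained under the integral sign.\<close>
  define E where "E x = integral {0..t} (\<lambda>s. \<i> * (of_real (D 0 s) * cis (x * (s - t))))" for x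
  have der: "(source_transform g t has_vector_derivative E x) (at x within U)"
    if "x \<in> U" "convex U" for x U
    unfolding source_transform_def[abs_def] E_def cbox_interval[symmetric]
  proof (rule leibniz_rule_vector_derivative[OF _ _ _ that])
    fix x s
    show "((\<lambda>x. of_real (g s) * cis (x * (s - t))) has_vector_derivative
        \<i> * (of_real (D 0 s) * cis (x * (s - t)))) (at x within U)"
      unfolding has_vector_derivative_def
      by (auto intro!: derivative_eq_intros simp: D_def scaleR_conv_of_real algebra_simps)
    show "(\<lambda>s. of_real (g s) * cis (x * (s - t))) integrable_on cbox 0 t"
      unfolding cbox_interval by (intro integrable_continuous_real continuous_intros gc)
    show "continuous_on (U \<times> cbox 0 t) (\<lambda>(x, s). \<i> * (of_real (D 0 s) * cis (x * (s - t))))"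
      unfolding D_def split_beta
      by (auto intro!: continuous_intros continuous_on_compose2[OF gc[of UNIV]])
  qed
  show ?thesis
  proof (intro exI conjI allI impI)
    fix U and d x y :: real
    assume U: "convex U" "x \<in> U" "y \<in> U" and d: "0 < d" and away: "\<forall>z\<in>U. d \<le> \<bar>z\<bar>"
    have "norm (source_transform g t x - source_transform g t y) \<le> B / d ^ m * norm (x - y)"
    proof (rule differentiable_bound[OF \<open>convex U\<close> _ _ \<open>x \<in> U\<close> \<open>y \<in> U\<close>])
      fix z assume z: "z \<in> U"
      show "(source_transform g t has_derivative (\<lambda>h. h *\<^sub>R E z)) (at z within U)"
        using der[OF z U(1)] by (simp add: has_vector_derivative_def)
      have "d ^ m * cmod (E z) \<le> \<bar>z\<bar> ^ m * cmod (E z)"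
        using away z d by (intro mult_right_mono power_mono) auto
      also have "\<dots> \<le> B" using B(2)[of z] by (simp add: E_def norm_mult)
      finally have "cmod (E z) \<le> B / d ^ m" using d by (simp add: field_simps)
      then show "onorm (\<lambda>h. h *\<^sub>R E z) \<le> B / d ^ m"
        by (simp add: onorm_scaleR_left onorm_id)
    qed
    then show "cmod (source_transform g t x - source_transform g t y) \<le> B / d ^ m * \<bar>x - y\<bar>"
      by simp
  qed (rule B(1))
qed

end

section \<open>Bounds on symbol and profile\<close>

lemma symbol_minus: "symbol a r (- \<kappa>) = symbol a r \<kappa>"
  by (simp add: symbol_def sum_negf)

lemma symbol_differentiable:
  assumes "\<kappa> \<noteq> 0"
  shows "symbol a r field_differentiable (at \<kappa>)"
proof -
  have "(\<lambda>\<kappa>. 2 / \<kappa> * (\<Sum>l=1..r. a l * sin (real l * \<kappa>))) field_differentiable (at \<kappa>)"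
    unfolding field_differentiable_def
    by (rule exI, (rule derivative_eq_intros refl assms)+)
  then show ?thesis
    unfolding field_differentiable_def
  proof (elim exE, intro exI)
    fix D assume "((\<lambda>\<kappa>. 2 / \<kappa> * (\<Sum>l=1..r. a l * sin (real l * \<kappa>))) has_real_derivative D) (at \<kappa>)"
    then show "(symbol a r has_real_derivative D) (at \<kappa>)"
      by (rule has_field_derivative_transform_within_open[of _ _ _ "- {0}"])
        (use assms in \<open>auto simp: symbol_def\<close>)
  qed
qed

lemma continuous_on_symbol: "continuous_on S (symbol a r)"
proof -
  have "isCont (symbol a r) \<kappa>" for \<kappa>
    using isCont_symbol_0 field_differentiable_imp_continuous_at[OF symbol_differentiable]
    by (cases "\<kappa> = 0") auto
  then show ?thesis by (simp add: continuous_at_imp_continuous_on)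
qed

text \<open>For \<open>p \<ge> 1\<close> the accuracy condition forces the limit 1 at zero, and the
  symbol is continuous there.\<close>

lemma accurate_imp_symbol_0:
  assumes "accurate_of_order p (symbol a r)" "p \<ge> 1"
  shows "symbol a r 0 = 1"
proof -
  obtain B where B: "eventually (\<lambda>x. norm (symbol a r x - 1) \<le> B * norm (x ^ p)) (at 0)"
    using assms(1) unfolding accurate_of_order_def by (auto elim!: landau_o.bigE)
  have "((\<lambda>x::real. B * norm (x ^ p)) \<longlongrightarrow> B * norm (0 ^ p :: real)) (at 0)"
    by (intro tendsto_intros)
  then have "((\<lambda>x::real. B * norm (x ^ p)) \<longlongrightarrow> 0) (at 0)" using assms(2) by (simp add: power_0_left)
  with B have "((\<lambda>\<kappa>. symbol a r \<kappa> - 1) \<longlongrightarrow> 0) (at 0)" by (rule Lim_null_comparison)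
  moreover have "((\<lambda>\<kappa>. symbol a r \<kappa> - 1) \<longlongrightarrow> symbol a r 0 - 1) (at 0)"
    using isCont_symbol_0[of a r] by (intro tendsto_intros) (simp add: isCont_def)
  ultimately have "symbol a r 0 - 1 = 0" by (rule LIM_unique[rotated])
  then show ?thesis by simp
qed

text \<open>Close to \<open>x0\<close> the difference quotient exceeds half of
  \<open>\<bar>d\<bar>\<close> in modulus; further left, monotonicity keeps \<open>q\<close> above a
  fixed positive value.\<close>

lemma simple_zero_lower_bound:
  fixes q :: "real \<Rightarrow> real"
  assumes der: "(q has_real_derivative d) (at x0)" and d: "d \<noteq> 0" and q0: "q x0 = 0"
    and mono: "\<And>x y. a \<le> x \<Longrightarrow> x < y \<Longrightarrow> y \<le> x0 \<Longrightarrow> q y < q x"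
  shows "\<exists>B>0. \<forall>x\<in>{a..x0}. x0 - x \<le> B * \<bar>q x\<bar>"
proof -
  have "((\<lambda>x. \<bar>(q x - q x0) / (x - x0)\<bar>) \<longlongrightarrow> \<bar>d\<bar>) (at x0)"
    using der by (intro tendsto_intros) (simp add: has_field_derivative_iff)
  then have "eventually (\<lambda>x. \<bar>d\<bar> / 2 < \<bar>(q x - q x0) / (x - x0)\<bar>) (at x0)"
    by (rule order_tendstoD) (use d in simp)
  then obtain e where e: "e > 0"
    "\<And>x. x \<noteq> x0 \<Longrightarrow> dist x x0 < e \<Longrightarrow> \<bar>d\<bar> / 2 < \<bar>(q x - q x0) / (x - x0)\<bar>"
    unfolding eventually_at by auto
  have near: "x0 - x \<le> 2 / \<bar>d\<bar> * \<bar>q x\<bar>" if "x0 - e < x" "x \<le> x0" for x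
    using e(2)[of x] that q0 d by (cases "x = x0") (auto simp: dist_real_def field_simps abs_divide)
  \<comment> \<open>\<open>y\<close> separates the far region \<open>x \<le> x0 - e\<close> from
    \<open>x0\<close>. If that region contains a point of \<open>{a..x0}\<close>, then
    \<open>q y\<close> is a positive lower bound for \<open>q\<close> on it, which gives the second
    entry of \<open>B\<close>.\<close>
  define y where "y = max a (x0 - e / 2)"
  define B where "B = max (2 / \<bar>d\<bar>) ((x0 - a) / \<bar>q y\<bar>)"
  have B: "B > 0" using d by (simp add: B_def less_max_iff_disj)
  have "x0 - x \<le> B * \<bar>q x\<bar>" if x: "x \<in> {a..x0}" for x
  proof (cases "x0 - e < x")
    case True
    then have "x0 - x \<le> 2 / \<bar>d\<bar> * \<bar>q x\<bar>" using near x by simp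
    also have "\<dots> \<le> B * \<bar>q x\<bar>" by (intro mult_right_mono) (simp_all add: B_def)
    finally show ?thesis .
  next
    case False
    then have y: "x < y" "y < x0" "a \<le> y" using e(1) x by (auto simp: y_def)
    then have "0 < q y" "q y < q x" using mono[of y x0] mono[of x y] q0 x by auto
    then have "x0 - x \<le> (x0 - a) / \<bar>q y\<bar> * \<bar>q y\<bar>" using x by simp
    also have "\<dots> \<le> B * \<bar>q x\<bar>"
      by (intro mult_mono) (use \<open>0 < q y\<close> \<open>q y < q x\<close> B in \<open>auto simp: B_def\<close>)
    finally show ?thesis .
  qed
  then show ?thesis using B by blast
qed

section \<open>Profile and phase of the scheme\<close>

context
  fixes p r :: nat and c v0 :: real and a :: "nat \<Rightarrow> real" and F :: "real \<Rightarrow> real"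
  assumes p: "p \<ge> 1" and c: "c > 0" and v0: "v0 < c"
    and acc: "accurate_of_order p (symbol a r)"
    and dec: "strictly_decreasing_in_abs (symbol a r)"
    and simple: "\<And>\<kappa>. is_kappa_star (symbol a r) c v0 \<kappa> \<Longrightarrow> deriv (symbol a r) \<kappa> \<noteq> 0"
    and adm: "admissible_profile (symbol a r) c v0 F"
    and mom: "moment_conditions p (symbol a r) c v0 F"
    and boom: "sonic_boom_conditions (p + 1) (symbol a r) c v0 F"
begin

lemma symbol_strict_antimono:
  "0 \<le> x \<Longrightarrow> x < y \<Longrightarrow> y \<le> pi \<Longrightarrow> symbol a r y < symbol a r x"
  using dec unfolding strictly_decreasing_in_abs_def by auto

lemma profile_end_pos: "profile_end (symbol a r) c v0 > 0"
proof (cases "\<exists>\<kappa>. is_kappa_star (symbol a r) c v0 \<kappa>")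
  case True
  then show ?thesis using profile_end_eq by (fastforce simp: is_kappa_star_def)
qed (simp add: profile_end_def)

text \<open>The order of vanishing of \<open>F\<close> at the sonic boom wavenumber compensates the degeneration of
  the phase \<open>k (c P - v\<^sub>0)\<close> there.\<close>

lemma profile_bounded_by_phase:
  "\<exists>C\<ge>0. \<forall>\<kappa>\<in>{0..pi}. \<bar>F \<kappa>\<bar> \<le> C * \<bar>c * symbol a r \<kappa> - v0\<bar> ^ (p + 1)"
proof (cases "\<exists>\<kappa>. is_kappa_star (symbol a r) c v0 \<kappa>")
  case True
  then obtain x0 where x0: "is_kappa_star (symbol a r) c v0 x0" by blast
  then have x0': "0 < x0" "x0 \<le> pi" "c * symbol a r x0 = v0" by (auto simp: is_kappa_star_def)
  have "smooth_on {0..x0} F" using adm profile_end_eq[OF x0] by (simp add: admissible_profile_def)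
  then have "Ck_on (p + 1) {0..x0} F" by (simp add: smooth_on_def)
  moreover have zero: "deriv_within {0..x0} F \<nu> x0 = 0" if "\<nu> < p + 1" for \<nu>
    using boom x0 that by (auto simp: sonic_boom_conditions_def)
  ultimately have "\<exists>B\<ge>0. \<forall>x\<in>{0..x0}. \<bar>F x - F x0\<bar> \<le> B * \<bar>x - x0\<bar> ^ (p + 1)"
    by (intro Ck_on_taylor_bound) (use x0' in auto)
  then obtain B1 where B1: "B1 \<ge> 0" "\<And>x. x \<in> {0..x0} \<Longrightarrow> \<bar>F x\<bar> \<le> B1 * \<bar>x - x0\<bar> ^ (p + 1)"
    using zero[of 0] by auto
  \<comment> \<open>Simplicity of the zero turns the distance to \<open>x0\<close> in the Taylor
    bound into the phase.\<close>
  have "\<exists>B>0. \<forall>x\<in>{0..x0}. x0 - x \<le> B * \<bar>c * symbol a r x - v0\<bar>"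
  proof (rule simple_zero_lower_bound)
    have "(symbol a r has_real_derivative deriv (symbol a r) x0) (at x0)"
      by (rule DERIV_deriv_iff_field_differentiable[THEN iffD2, OF symbol_differentiable])
        (use x0' in auto)
    then show "((\<lambda>x. c * symbol a r x - v0) has_real_derivative c * deriv (symbol a r) x0) (at x0)"
      by (auto intro!: derivative_eq_intros)
    show "c * deriv (symbol a r) x0 \<noteq> 0" using simple[OF x0] c by simp
    show "c * symbol a r x0 - v0 = 0" using x0' by simp
    fix x y :: real assume "0 \<le> x" "x < y" "y \<le> x0"
    then show "c * symbol a r y - v0 < c * symbol a r x - v0"
      using symbol_strict_antimono[of x y] x0' c by simp
  qed
  then obtain B2 where B2: "B2 > 0"
    "\<And>x. x \<in> {0..x0} \<Longrightarrow> x0 - x \<le> B2 * \<bar>c * symbol a r x - v0\<bar>" by blast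
  have "\<bar>F x\<bar> \<le> B1 * B2 ^ (p + 1) * \<bar>c * symbol a r x - v0\<bar> ^ (p + 1)" if x: "x \<in> {0..pi}" for x
  proof (cases "x \<le> x0")
    case True
    have "\<bar>F x\<bar> \<le> B1 * \<bar>x - x0\<bar> ^ (p + 1)" using B1 x True by simp
    also have "\<dots> \<le> B1 * (B2 * \<bar>c * symbol a r x - v0\<bar>) ^ (p + 1)"
      by (intro mult_left_mono power_mono) (use B1 B2(2)[of x] x True in auto)
    finally show ?thesis by (simp only: power_mult_distrib mult.assoc)
  next
    case False
    then have "F x = 0" using boom x0 by (auto simp: sonic_boom_conditions_def)
    then show ?thesis using B1 B2 by simp
  qed
  then show ?thesis using B1 B2 by (intro exI[of _ "B1 * B2 ^ (p + 1)"]) auto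
next
  case False
  \<comment> \<open>Without a sonic boom wavenumber the phase has the positive minimum
    \<open>d\<close>, attained at \<open>pi\<close>, and boundedness of \<open>F\<close> suffices.
    Positivity: the phase at 0 is \<open>c - v0 > 0\<close>, so a sign change would produce a zero,
    which strict monotonicity makes the smallest one.\<close>
  define d where "d = c * symbol a r pi - v0"
  have d: "d > 0"
  proof (rule ccontr)
    assume "\<not> d > 0"
    then have "\<exists>x\<ge>0. x \<le> pi \<and> c * symbol a r x = v0"
      using v0 accurate_imp_symbol_0[OF acc p]
      by (intro IVT2') (auto simp: d_def intro!: continuous_intros continuous_on_symbol)
    then obtain x where x: "0 \<le> x" "x \<le> pi" "c * symbol a r x = v0" by blast
    have "x \<noteq> 0" using x v0 accurate_imp_symbol_0[OF acc p] by auto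
    moreover have "x \<le> y" if "y \<in> {0<..pi}" "c * symbol a r y = v0" for y
      using symbol_strict_antimono[of y x] that x c by (force simp: not_less[symmetric])
    ultimately have "is_kappa_star (symbol a r) c v0 x" using x by (auto simp: is_kappa_star_def)
    then show False using False by blast
  qed
  obtain B where B: "B > 0" "\<And>x. \<bar>F x\<bar> \<le> B"
    using adm by (auto simp: admissible_profile_def bounded_pos)
  have "\<bar>F x\<bar> \<le> B / d ^ (p + 1) * \<bar>c * symbol a r x - v0\<bar> ^ (p + 1)" if x: "x \<in> {0..pi}" for x
  proof -
    have "d \<le> c * symbol a r x - v0"
      using symbol_strict_antimono[of x pi] x c by (cases "x = pi") (auto simp: d_def)
    then have "d ^ (p + 1) \<le> \<bar>c * symbol a r x - v0\<bar> ^ (p + 1)"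
      by (intro power_mono) (use d in auto)
    then have "B / d ^ (p + 1) * d ^ (p + 1)
        \<le> B / d ^ (p + 1) * \<bar>c * symbol a r x - v0\<bar> ^ (p + 1)"
      by (intro mult_left_mono) (use B d in auto)
    then show ?thesis using B(2)[of x] d by simp
  qed
  then show ?thesis using B d by (intro exI[of _ "B / d ^ (p + 1)"]) auto
qed

text \<open>Combines the Taylor bound at 0, the order of accuracy, and continuity of the phase,
  whose value at 0 is \<open>c - v0\<close>. The threshold also stays below the end of the interval
  on which \<open>F\<close> is smooth.\<close>

lemma small_wavenumber_bounds:
  "\<exists>\<kappa>0>0. \<exists>C\<ge>0. \<forall>\<kappa>\<in>{0<..<\<kappa>0}. \<bar>F \<kappa> - 1\<bar> \<le> C * \<kappa> ^ p \<and> \<bar>symbol a r \<kappa> - 1\<bar> \<le> C * \<kappa> ^ p \<and>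
     (c - v0) / 2 \<le> c * symbol a r \<kappa> - v0"
proof -
  let ?b = "profile_end (symbol a r) c v0"
  have "\<exists>B\<ge>0. \<forall>x\<in>{0..?b}. \<bar>F x - F 0\<bar> \<le> B * \<bar>x - 0\<bar> ^ p"
    by (rule Ck_on_taylor_bound)
      (use adm mom p profile_end_pos in
        \<open>auto simp: admissible_profile_def moment_conditions_def smooth_on_def\<close>)
  then obtain B1 where B1: "B1 \<ge> 0" "\<And>x. x \<in> {0..?b} \<Longrightarrow> \<bar>F x - 1\<bar> \<le> B1 * \<bar>x\<bar> ^ p"
    using mom by (auto simp: moment_conditions_def)
  obtain B2 where B2: "B2 > 0" "eventually (\<lambda>x. \<bar>symbol a r x - 1\<bar> \<le> B2 * \<bar>x\<bar> ^ p) (at 0)"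
    using acc unfolding accurate_of_order_def by (auto elim!: landau_o.bigE simp: power_abs)
  have "((\<lambda>x. c * symbol a r x - v0) \<longlongrightarrow> c * symbol a r 0 - v0) (at 0)"
    using isCont_symbol_0[of a r] by (intro tendsto_intros) (simp add: isCont_def)
  then have "eventually (\<lambda>x. (c - v0) / 2 < c * symbol a r x - v0) (at 0)"
    by (rule order_tendstoD) (use accurate_imp_symbol_0[OF acc p] v0 in simp)
  with B2(2) have "eventually (\<lambda>x. \<bar>symbol a r x - 1\<bar> \<le> B2 * \<bar>x\<bar> ^ p \<and>
      (c - v0) / 2 < c * symbol a r x - v0) (at 0)" by (rule eventually_conj)
  then obtain e where e: "e > 0" "\<And>x. x \<noteq> 0 \<Longrightarrow> \<bar>x\<bar> < e \<Longrightarrow>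
      \<bar>symbol a r x - 1\<bar> \<le> B2 * \<bar>x\<bar> ^ p \<and> (c - v0) / 2 < c * symbol a r x - v0"
    unfolding eventually_at by auto
  have "\<bar>F x - 1\<bar> \<le> max B1 B2 * x ^ p \<and> \<bar>symbol a r x - 1\<bar> \<le> max B1 B2 * x ^ p \<and>
     (c - v0) / 2 \<le> c * symbol a r x - v0" if x: "x \<in> {0<..<min e ?b}" for x
  proof -
    have "B1 * x ^ p \<le> max B1 B2 * x ^ p" "B2 * x ^ p \<le> max B1 B2 * x ^ p"
      using x by (auto intro!: mult_right_mono)
    moreover have "\<bar>F x - 1\<bar> \<le> B1 * x ^ p" using B1(2)[of x] x by simp
    moreover have "\<bar>symbol a r x - 1\<bar> \<le> B2 * x ^ p" "(c - v0) / 2 < c * symbol a r x - v0"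
      using e(2)[of x] x by simp_all
    ultimately show ?thesis by linarith
  qed
  then show ?thesis using e(1) profile_end_pos B2(1)
    by (intro exI[of _ "min e ?b"] exI[of _ "max B1 B2"] conjI) (auto simp: le_max_iff_disj)
qed

section \<open>Error estimate\<close>

text \<open>Stated for all real \<open>k\<close> and \<open>h\<close> with
  \<open>\<bar>k\<bar> * h \<le> pi\<close>, so that the constant cannot depend on the grid.\<close>

lemma amplitude_error_bound:
  assumes g: "Ck_on (p + 2) UNIV g" and t: "0 \<le> t"
    and zero: "\<And>s. s \<le> 0 \<Longrightarrow> g s = 0" "\<And>s. s \<ge> t \<Longrightarrow> g s = 0"
  shows "\<exists>C. \<forall>k h. k \<noteq> 0 \<longrightarrow> h > 0 \<longrightarrow> \<bar>k\<bar> * h \<le> pi \<longrightarrow>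
    cmod (of_real (F (k * h)) * source_transform g t (k * (c * symbol a r (k * h) - v0))
      - source_transform g t (k * (c - v0))) \<le> C * (h ^ p / \<bar>k\<bar>)"
proof -
  let ?E = "source_transform g t"
  obtain A where A: "A \<ge> 0" "\<And>\<omega>. \<bar>\<omega>\<bar> ^ (p + 1) * cmod (?E \<omega>) \<le> A"
    using source_transform_decay[OF g t zero, of "p + 1"] by auto
  obtain B where B: "B \<ge> 0" "\<And>U d x y. convex U \<Longrightarrow> x \<in> U \<Longrightarrow> y \<in> U \<Longrightarrow> 0 < d \<Longrightarrow>
      (\<And>z. z \<in> U \<Longrightarrow> d \<le> \<bar>z\<bar>) \<Longrightarrow> cmod (?E x - ?E y) \<le> B / d ^ (p + 2) * \<bar>x - y\<bar>"
    using source_transform_difference_decay[OF g t zero] by metis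
  obtain Cf where Cf: "Cf \<ge> 0"
    "\<And>\<kappa>. \<kappa> \<in> {0..pi} \<Longrightarrow> \<bar>F \<kappa>\<bar> \<le> Cf * \<bar>c * symbol a r \<kappa> - v0\<bar> ^ (p + 1)"
    using profile_bounded_by_phase by blast
  obtain \<kappa>0 C1 where \<kappa>0: "\<kappa>0 > 0" and C1: "C1 \<ge> 0"
    and small: "\<And>\<kappa>. 0 < \<kappa> \<Longrightarrow> \<kappa> < \<kappa>0 \<Longrightarrow> \<bar>F \<kappa> - 1\<bar> \<le> C1 * \<kappa> ^ p \<and>
      \<bar>symbol a r \<kappa> - 1\<bar> \<le> C1 * \<kappa> ^ p \<and> (c - v0) / 2 \<le> c * symbol a r \<kappa> - v0"
    using small_wavenumber_bounds by (auto simp: Ball_def)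
  define q0 where "q0 = (c - v0) / 2"
  have q0: "q0 > 0" "q0 \<le> c - v0" using v0 by (auto simp: q0_def)
  \<comment> \<open>\<open>D1\<close> serves \<open>\<kappa> < \<kappa>0\<close>: its summands come
    from \<open>F - 1\<close> and from the phase error. \<open>D2\<close> serves the other \<kappa>,
    where the two terms are bounded separately and \<open>1 \<le> (\<kappa> / \<kappa>0) ^ p\<close>
    supplies the missing power.\<close>
  define D1 where "D1 = C1 * A / q0 ^ (p + 1) + B * c * C1 / q0 ^ (p + 2)"
  define D2 where "D2 = (Cf * A + A / q0 ^ (p + 1)) / \<kappa>0 ^ p"
  have D: "D1 \<ge> 0" "D2 \<ge> 0" using A B Cf C1 \<kappa>0 q0 c by (auto simp: D1_def D2_def)
  have "cmod (of_real (F (k * h)) * ?E (k * (c * symbol a r (k * h) - v0)) - ?E (k * (c - v0)))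
      \<le> (D1 + D2) * (h ^ p / \<bar>k\<bar>)" if k: "k \<noteq> 0" and h: "h > 0" and kh: "\<bar>k\<bar> * h \<le> pi" for k h
  proof -
    define K where "K = \<bar>k\<bar>"
    define \<kappa> where "\<kappa> = K * h"
    have K: "K > 0" using k by (simp add: K_def)
    have \<kappa>: "\<kappa> > 0" "\<kappa> \<le> pi" using K h kh by (auto simp: \<kappa>_def K_def)
    have X: "\<kappa> ^ p / K ^ (p + 1) = h ^ p / K" using K by (simp add: \<kappa>_def power_mult_distrib)
    have "k * h = \<kappa> \<or> k * h = - \<kappa>" by (auto simp: \<kappa>_def K_def abs_if)
    then have F_eq: "F (k * h) = F \<kappa>" and P_eq: "symbol a r (k * h) = symbol a r \<kappa>"
      using adm by (auto simp: admissible_profile_def symbol_minus)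
    define q where "q = c * symbol a r \<kappa> - v0"
    \<comment> \<open>The weight in \<open>x\<close> is kept, because the discrete phase may vanish;
      the bound on \<open>F\<close> will absorb it.\<close>
    have dec: "\<bar>x\<bar> ^ (p + 1) * cmod (?E (k * x)) \<le> A / K ^ (p + 1)" for x
      using A(2)[of "k * x"] K
      by (simp add: K_def[symmetric] abs_mult power_mult_distrib pos_le_divide_eq mult_ac)
    have dec0: "cmod (?E (k * x)) \<le> A / q0 ^ (p + 1) / K ^ (p + 1)" if x: "q0 \<le> x" for x
    proof -
      have "q0 ^ (p + 1) * cmod (?E (k * x)) \<le> \<bar>x\<bar> ^ (p + 1) * cmod (?E (k * x))"
        by (intro mult_right_mono power_mono) (use q0 x in auto)
      also note dec[of x]
      finally show ?thesis using q0 K by (simp add: field_simps)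
    qed
    have "cmod (of_real (F \<kappa>) * ?E (k * q) - ?E (k * (c - v0))) \<le> (D1 + D2) * (\<kappa> ^ p / K ^ (p + 1))"
    proof (cases "\<kappa> < \<kappa>0")
      case True
      note s = small[OF \<kappa>(1) True]
      have qq: "q0 \<le> q" using s by (simp add: q0_def q_def)
      \<comment> \<open>The half-line on the side of the sign of \<open>k\<close>: it contains both
        phases and keeps distance \<open>K * q0\<close> from zero.\<close>
      define U where "U = (if k > 0 then {K * q0..} else {..- (K * q0)})"
      have mem: "k * x \<in> U" if "q0 \<le> x" for x
        using that k by (auto simp: U_def K_def abs_if mult_left_mono_neg)
      have "cmod (?E (k * q) - ?E (k * (c - v0)))
          \<le> B / (K * q0) ^ (p + 2) * \<bar>k * q - k * (c - v0)\<bar>"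
      proof (rule B(2)[of U])
        show "K * q0 \<le> \<bar>z\<bar>" if "z \<in> U" for z
          using that by (auto simp: U_def split: if_splits)
      qed (use K q0 qq mem in \<open>auto simp: U_def\<close>)
      also have "k * q - k * (c - v0) = k * c * (symbol a r \<kappa> - 1)"
        by (simp add: q_def algebra_simps)
      also have "\<bar>k * c * (symbol a r \<kappa> - 1)\<bar> = K * c * \<bar>symbol a r \<kappa> - 1\<bar>"
        using c by (simp add: abs_mult K_def)
      also have "B / (K * q0) ^ (p + 2) * (K * c * \<bar>symbol a r \<kappa> - 1\<bar>)
          \<le> B / (K * q0) ^ (p + 2) * (K * c * (C1 * \<kappa> ^ p))"
        by (intro mult_left_mono) (use s B K c q0 in auto)
      also have "\<dots> = B * c * C1 / q0 ^ (p + 2) * (\<kappa> ^ p / K ^ (p + 1))"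
        using K q0 by (simp add: field_simps)
      finally have 1: "cmod (?E (k * q) - ?E (k * (c - v0)))
          \<le> B * c * C1 / q0 ^ (p + 2) * (\<kappa> ^ p / K ^ (p + 1))" .
      have "cmod (of_real (F \<kappa> - 1) * ?E (k * q)) = \<bar>F \<kappa> - 1\<bar> * cmod (?E (k * q))"
        by (simp only: norm_mult norm_of_real)
      also have "\<dots> \<le> (C1 * \<kappa> ^ p) * (A / q0 ^ (p + 1) / K ^ (p + 1))"
        by (intro mult_mono) (use s dec0[OF qq] C1 \<kappa> in auto)
      finally have 2: "cmod (of_real (F \<kappa> - 1) * ?E (k * q))
          \<le> C1 * A / q0 ^ (p + 1) * (\<kappa> ^ p / K ^ (p + 1))" by (simp add: mult_ac)
      \<comment> \<open>Separates the amplitude error of the source from the phase error of the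
        difference operator.\<close>
      have "of_real (F \<kappa>) * ?E (k * q) - ?E (k * (c - v0))
          = of_real (F \<kappa> - 1) * ?E (k * q) + (?E (k * q) - ?E (k * (c - v0)))"
        by (simp add: algebra_simps)
      then have "cmod (of_real (F \<kappa>) * ?E (k * q) - ?E (k * (c - v0)))
          \<le> cmod (of_real (F \<kappa> - 1) * ?E (k * q)) + cmod (?E (k * q) - ?E (k * (c - v0)))"
        by (simp only: norm_triangle_ineq)
      also have "\<dots> \<le> D1 * (\<kappa> ^ p / K ^ (p + 1))"
        unfolding D1_def distrib_right by (rule add_mono[OF 2 1])
      also have "\<dots> \<le> (D1 + D2) * (\<kappa> ^ p / K ^ (p + 1))"
        by (intro mult_right_mono) (use D \<kappa> K in auto)
      finally show ?thesis .
    next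
      case False
      have "cmod (of_real (F \<kappa>) * ?E (k * q)) = \<bar>F \<kappa>\<bar> * cmod (?E (k * q))"
        by (simp add: norm_mult)
      \<comment> \<open>The zero of \<open>F\<close> pays for the possible zero of the phase
        \<open>q\<close>.\<close>
      also have "\<dots> \<le> Cf * \<bar>q\<bar> ^ (p + 1) * cmod (?E (k * q))"
        by (intro mult_right_mono) (use Cf(2)[of \<kappa>] \<kappa> in \<open>auto simp: q_def\<close>)
      also have "\<dots> \<le> Cf * (A / K ^ (p + 1))"
        unfolding mult.assoc by (intro mult_left_mono dec Cf)
      finally have "cmod (of_real (F \<kappa>) * ?E (k * q) - ?E (k * (c - v0)))
          \<le> Cf * (A / K ^ (p + 1)) + A / q0 ^ (p + 1) / K ^ (p + 1)"
        using dec0[OF q0(2)]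
          norm_triangle_ineq4[of "of_real (F \<kappa>) * ?E (k * q)" "?E (k * (c - v0))"] by linarith
      also have "\<dots> = (Cf * A + A / q0 ^ (p + 1)) / K ^ (p + 1)"
        by (simp only: add_divide_distrib times_divide_eq_right)
      also have "\<dots> = D2 * (\<kappa>0 ^ p / K ^ (p + 1))"
        using \<kappa>0 by (simp add: D2_def)
      also have "\<dots> \<le> (D1 + D2) * (\<kappa> ^ p / K ^ (p + 1))"
        by (intro mult_mono divide_right_mono power_mono) (use D \<kappa>0 \<kappa> K False in auto)
      finally show ?thesis .
    qed
    then show ?thesis unfolding X unfolding F_eq P_eq q_def K_def .
  qed
  then show ?thesis by blast
qed

end

text \<open>The largest product is \<open>2 * pi * N / (2 * N + 1)\<close>.\<close>

lemma grid_wavenumber_spacing_le_pi: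
  assumes "L > 0" "k \<in> grid_wavenumbers L N"
  shows "\<bar>k\<bar> * grid_spacing L N \<le> pi"
proof -
  obtain n :: int where n: "k = 2 * pi * of_int n / L" "\<bar>n\<bar> \<le> int N"
    using assms(2) by (fastforce simp: grid_wavenumbers_def abs_le_iff)
  have "real_of_int \<bar>n\<bar> \<le> real N" using n(2) by linarith
  then have "2 * real_of_int \<bar>n\<bar> \<le> real (grid_size N)" by (simp add: grid_size_def)
  then have "pi * (2 * real_of_int \<bar>n\<bar>) \<le> pi * real (grid_size N)" by (intro mult_left_mono) auto
  moreover have "\<bar>k\<bar> * grid_spacing L N = pi * (2 * real_of_int \<bar>n\<bar>) / real (grid_size N)"
    using assms(1) by (simp add: n grid_spacing_def abs_mult)
  moreover have "real (grid_size N) > 0" by (simp add: grid_size_def)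
  ultimately show ?thesis by (simp add: pos_divide_le_eq)
qed

theorem theorem1:
  fixes p r :: nat
    and L c v0 t1 :: real
    and a :: "nat \<Rightarrow> real"
    and g F :: "real \<Rightarrow> real"
    and u :: "real \<Rightarrow> real \<Rightarrow> complex"
    and U :: "nat \<Rightarrow> real \<Rightarrow> int \<Rightarrow> complex"
  assumes "p \<ge> 1" and "L > 0" and "c > 0" and "v0 < c" and "t1 > 0"
    and "accurate_of_order p (symbol a r)"
    and "strictly_decreasing_in_abs (symbol a r)"
    and "\<And>\<kappa>. is_kappa_star (symbol a r) c v0 \<kappa> \<Longrightarrow> deriv (symbol a r) \<kappa> \<noteq> 0"
    and "Ck_on (p + 2) UNIV g"
    and "\<And>t. t \<le> 0 \<Longrightarrow> g t = 0" and "\<And>t. t \<ge> t1 \<Longrightarrow> g t = 0"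
    and "admissible_profile (symbol a r) c v0 F"
    and "moment_conditions p (symbol a r) c v0 F"
    and "sonic_boom_conditions (p + 1) (symbol a r) c v0 F"
    and "exact_solution L c v0 g u"
    and "\<And>N. N \<ge> 1 \<Longrightarrow> semidiscrete_solution L c v0 a r g F N (U N)"
  shows "\<forall>t\<ge>t1. (\<forall>N\<ge>1. fourier_error L u N (U N) t 0 = 0) \<and>
    (\<exists>C. \<forall>N\<ge>1. \<forall>k \<in> grid_wavenumbers L N - {0}.
       cmod (fourier_error L u N (U N) t k) \<le> C * (grid_spacing L N ^ p / \<bar>k\<bar>))"
proof (intro allI impI conjI)
  fix t assume t: "t \<ge> t1"
  then have t0: "t \<ge> 0" using \<open>t1 > 0\<close> by simp
  let ?E = "source_transform g t"
  have err: "fourier_error L u N (U N) t k = 1 / of_real L * cis (- (k * v0 * t)) *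
      (of_real (F (k * grid_spacing L N)) *
        ?E (k * (c * symbol a r (k * grid_spacing L N) - v0)) - ?E (k * (c - v0)))"
    if "N \<ge> 1" "k \<in> grid_wavenumbers L N" for N k
  proof -
    have "k \<in> wavenumbers L"
      using that(2) by (auto simp: grid_wavenumbers_def wavenumbers_def)
    from exact_fourier_coeff[OF assms(15) this t0]
      semidiscrete_fourier_coeff[OF assms(16)[OF that(1)] \<open>L > 0\<close> that(2) t0]
    show ?thesis by (simp add: fourier_error_def right_diff_distrib)
  qed
  {
    fix N :: nat assume "N \<ge> 1"
    moreover have "0 \<in> grid_wavenumbers L N"
      unfolding grid_wavenumbers_def by (rule image_eqI[of _ _ 0]) auto
    \<comment> \<open>At \<open>k = 0\<close> both phases are zero, so the two transforms agree and
      \<open>F 0 = 1\<close> makes them cancel.\<close>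
    moreover have "F 0 = 1" using assms(13) by (simp add: moment_conditions_def)
    ultimately show "fourier_error L u N (U N) t 0 = 0" by (simp add: err)
  }
  \<comment> \<open>The source is already switched off at the observation time \<open>t\<close>, as
    the decay estimates on \<open>{0..t}\<close> require.\<close>
  have "g s = 0" if "s \<ge> t" for s using assms(11) that t by auto
  then obtain C where C: "\<And>k h. k \<noteq> 0 \<Longrightarrow> h > 0 \<Longrightarrow> \<bar>k\<bar> * h \<le> pi \<Longrightarrow>
    cmod (of_real (F (k * h)) * ?E (k * (c * symbol a r (k * h) - v0)) - ?E (k * (c - v0)))
      \<le> C * (h ^ p / \<bar>k\<bar>)"
    using amplitude_error_bound[OF assms(1,3,4,6-8,12-14,9) t0 assms(10)] by blast
  show "\<exists>C. \<forall>N\<ge>1. \<forall>k \<in> grid_wavenumbers L N - {0}.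
       cmod (fourier_error L u N (U N) t k) \<le> C * (grid_spacing L N ^ p / \<bar>k\<bar>)"
  \<comment> \<open>The prefactor common to both coefficients has modulus
    \<open>1 / L\<close>.\<close>
  proof (intro exI[of _ "C / L"] allI impI ballI)
    fix N :: nat and k assume N: "N \<ge> 1" and k: "k \<in> grid_wavenumbers L N - {0}"
    have "cmod (fourier_error L u N (U N) t k) = 1 / L * cmod (of_real (F (k * grid_spacing L N)) *
        ?E (k * (c * symbol a r (k * grid_spacing L N) - v0)) - ?E (k * (c - v0)))"
      using k \<open>L > 0\<close> by (simp add: err[OF N] norm_mult norm_divide)
    also have "\<dots> \<le> 1 / L * (C * (grid_spacing L N ^ p / \<bar>k\<bar>))"
      by (intro mult_left_mono C grid_spacing_pos grid_wavenumber_spacing_le_pi)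
        (use k \<open>L > 0\<close> in auto)
    finally show "cmod (fourier_error L u N (U N) t k) \<le> C / L * (grid_spacing L N ^ p / \<bar>k\<bar>)"
      by simp
  qed
qed

end
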